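(* Let $p$ be a prime number, let $R$ be a perfect (commutative, unital) $\mathbb{F}_p$-algebra, and let $n$ be an integer with $n\geq 2$ and $p\geq n$. Let $\alpha_n\colon \mathbb{Z}R/I^n \xrightarrow{\sim} W_n(R)=R^n$ be the canonical ring isomorphism. Let $x\in\mathbb{Z}R/I^n$, and write $\alpha_n(x)=(r_0,r_1,\dots,r_{n-1})$. Then, denoting also by $x\in\mathbb{Z}R$ any representative of the class $x$, the components are recursively given by $$r_0=\pi(x),\qquad r_\nu=\pi\bigl(\delta(\cdots\delta(\delta(x-[r_0])-[r_1])\cdots-[r_{\nu-1}])\bigr)\quad\text{for }\nu=1,\dots,n-1.$$ Explicitly: setting $y_0=x\in\mathbb{Z}R$ and $y_\nu=\delta(y_{\nu-1}-[r_{\nu-1}])\in\mathbb{Z}R$ for $1\le\nu\le n-1$, one has $r_\nu=\pi(y_\nu)$ for all $0\le\nu\le n-1$.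
   Context: Let $p$ be a prime and $R$ a perfect $\mathbb{F}_p$-algebra, i.e. a commutative unital $\mathbb{F}_p$-algebra whose Frobenius $\phi\colon R\to R$, $r\mapsto r^p$, is bijective. $\mathbb{Z}R$ denotes the monoid algebra over $\mathbb{Z}$ of the multiplicative monoid $(R,\cdot)$: it is the free abelian group on symbols $[r]$, $r\in R$, with multiplication determined by $[r][s]=[rs]$ and unit $[1]=1$. Let $\pi\colon\mathbb{Z}R\to R$, $\sum n_r[r]\mapsto\sum n_r r$, be the natural ring projection and $I=\ker\pi$. Let $\phi\colon\mathbb{Z}R\to\mathbb{Z}R$ also denote the ring endomorphism $\sum n_r[r]\mapsto\sum n_r[r^p]$. One has $\phi(x)\equiv x^p \bmod p\mathbb{Z}R$ for $x\in\mathbb{Z}R$, and $\mathbb{Z}R$ is torsion-free, so there is a well-defined map (the "arithmetic derivation") $\delta\colon\mathbb{Z}R\to\mathbb{Z}R$, $\delta(x)=\frac1p(\phi(x)-x^p)$. $W_n(R)$ is the ring of $p$-typical Witt vectors of length $n$ over $R$, whose underlying set is $R^n$ (with components indexed $0,\dots,n-1$). The canonical ring isomorphism $\alpha_n\colon\mathbb{Z}R/I^n\to W_n(R)$ is the inverse of the (known) ring isomorphism $\beta_n\colon W_n(R)\to\mathbb{Z}R/I^n$ given by $$\beta_n(r_0,r_1,\dots,r_{n-1})=\sum_{k=0}^{n-1}p^k[\phi^{-k}(r_k)]\bmod I^n,$$ where $\phi^{-k}$ is the $k$-th iterate of the inverse of the Frobenius automorphism of $R$. *)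

theory Defs
  imports
    "HOL-Library.Poly_Mapping"
    "HOL-Library.FuncSet"
    "HOL-Computational_Algebra.Primes"
    "HOL-Algebra.Ideal_Product"
    "HOL-Algebra.QuotRing"
    "HOL-Algebra.Algebraic_Closure_Type"
begin

text \<open>
  The coefficient ring is a type of sort \<open>{comm_ring, comm_monoid_mult}\<close>: this is
  the class of commutative unital rings. The class \<open>comm_ring_1\<close> additionally demands
  \<open>0 \<noteq> 1\<close> and would exclude the zero ring. As \<open>of_int\<close> is not available in this sort,
  the action of the integers on an abelian group is spelled out.
\<close>

definition zmult :: "int \<Rightarrow> 'a::ab_group_add \<Rightarrow> 'a" where
  "zmult k a = (if 0 \<le> k then (\<Sum>i<nat k. a) else - (\<Sum>i<nat (- k). a))"

definition frob :: "nat \<Rightarrow> 'r::{comm_ring, comm_monoid_mult} \<Rightarrow> 'r" where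
  "frob p r = r ^ p"


section \<open>The monoid algebra of the multiplicative monoid\<close>

text \<open>
  The ring structure on \<open>'m \<Rightarrow>\<^sub>0 int\<close> in the library is the monoid algebra of an
  additively written monoid \<open>'m\<close>. The type \<open>'r mulmon\<close> is the multiplicative
  monoid of \<open>'r\<close>, written additively.
\<close>

datatype 'r mulmon = Mul (unMul: 'r)

instantiation mulmon :: (comm_monoid_mult) comm_monoid_add
begin

definition zero_mulmon :: "'a mulmon" where
  "zero_mulmon = Mul 1"

definition plus_mulmon :: "'a mulmon \<Rightarrow> 'a mulmon \<Rightarrow> 'a mulmon" where
  "plus_mulmon a b = Mul (unMul a * unMul b)"

instance
  by standard (auto simp: zero_mulmon_def plus_mulmon_def mult_ac)

end

type_synonym 'r ZR = "'r mulmon \<Rightarrow>\<^sub>0 int"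

definition symb :: "'r \<Rightarrow> 'r ZR" where
  "symb r = frag_of (Mul r)"

lemma symb_1: "symb 1 = 1"
  by (simp add: symb_def single_one flip: zero_mulmon_def)

lemma symb_mult: "symb r * symb s = symb (r * s)"
  by (simp add: symb_def mult_single plus_mulmon_def)

definition proj :: "'r::{comm_ring, comm_monoid_mult} ZR \<Rightarrow> 'r" where
  "proj x = (\<Sum>m\<in>Poly_Mapping.keys x. zmult (Poly_Mapping.lookup x m) (unMul m))"

definition phi :: "nat \<Rightarrow> 'r::{comm_ring, comm_monoid_mult} ZR \<Rightarrow> 'r ZR" where
  "phi p = frag_extend (\<lambda>m. symb (frob p (unMul m)))"

text \<open>
  The quotient by \<open>p\<close> exists if \<open>p\<close> is prime, and it is unique because
  the additive group of \<open>'r ZR\<close> is free.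
\<close>

definition delta :: "nat \<Rightarrow> 'r::{comm_ring, comm_monoid_mult} ZR \<Rightarrow> 'r ZR" where
  "delta p x = (THE y. of_nat p * y = phi p x - x ^ p)"

abbreviation ZRing :: "'r::{comm_ring, comm_monoid_mult} ZR ring" where
  "ZRing \<equiv> ring_of_type_algebra"

definition aug :: "'r::{comm_ring, comm_monoid_mult} ZR set" where
  "aug = {x. proj x = 0}"

definition aug_pow :: "nat \<Rightarrow> 'r::{comm_ring, comm_monoid_mult} ZR set" where
  "aug_pow n = aug [^]\<^bsub>ideals_set ZRing\<^esub> n"


section \<open>Witt vectors of finite length\<close>

text \<open>
  Integer polynomials in the variables \<open>X\<^sub>0, X\<^sub>1, \<dots>\<close> (indices \<open>Inl k\<close>) and
  \<open>Y\<^sub>0, Y\<^sub>1, \<dots>\<close> (indices \<open>Inr k\<close>); the keys of a polynomial are exponent vectors.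
\<close>

type_synonym wpoly = "(nat + nat \<Rightarrow>\<^sub>0 nat) \<Rightarrow>\<^sub>0 int"

definition wvar :: "nat + nat \<Rightarrow> wpoly" where
  "wvar v = Poly_Mapping.single (Poly_Mapping.single v 1) 1"

definition weval :: "(nat + nat \<Rightarrow> 'r) \<Rightarrow> wpoly \<Rightarrow> 'r::{comm_ring, comm_monoid_mult}" where
  "weval a P = (\<Sum>m\<in>Poly_Mapping.keys P. zmult (Poly_Mapping.lookup P m)
     (\<Prod>v\<in>Poly_Mapping.keys m. a v ^ Poly_Mapping.lookup m v))"

definition ghost :: "nat \<Rightarrow> nat \<Rightarrow> (nat \<Rightarrow> wpoly) \<Rightarrow> wpoly" where
  "ghost p k Z = (\<Sum>i\<le>k. of_nat p ^ i * Z i ^ (p ^ (k - i)))"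

text \<open>
  For \<open>p\<close> prime, Witt's theorem says that the following sequences of integer
  polynomials exist and are unique.
\<close>

definition witt_S :: "nat \<Rightarrow> nat \<Rightarrow> wpoly" where
  "witt_S p = (THE S. \<forall>k. ghost p k S =
     ghost p k (\<lambda>i. wvar (Inl i)) + ghost p k (\<lambda>i. wvar (Inr i)))"

definition witt_P :: "nat \<Rightarrow> nat \<Rightarrow> wpoly" where
  "witt_P p = (THE P. \<forall>k. ghost p k P =
     ghost p k (\<lambda>i. wvar (Inl i)) * ghost p k (\<lambda>i. wvar (Inr i)))"

definition witt_ring :: "nat \<Rightarrow> nat \<Rightarrow> (nat \<Rightarrow> 'r::{comm_ring, comm_monoid_mult}) ring" where
  "witt_ring p n = \<lparr>
     carrier = {..<n} \<rightarrow>\<^sub>E UNIV,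
     monoid.mult = (\<lambda>a b. \<lambda>k\<in>{..<n}. weval (case_sum a b) (witt_P p k)),
     one = (\<lambda>k\<in>{..<n}. if k = 0 then 1 else 0),
     ring.zero = (\<lambda>k\<in>{..<n}. 0),
     add = (\<lambda>a b. \<lambda>k\<in>{..<n}. weval (case_sum a b) (witt_S p k))\<rparr>"


section \<open>The canonical isomorphism\<close>

definition beta :: "nat \<Rightarrow> nat \<Rightarrow> (nat \<Rightarrow> 'r::{comm_ring, comm_monoid_mult}) \<Rightarrow> 'r ZR set" where
  "beta p n r = aug_pow n +>\<^bsub>ZRing\<^esub>
     (\<Sum>k<n. of_nat p ^ k * symb ((inv_into UNIV (frob p) ^^ k) (r k)))"

text \<open>
  For \<open>p\<close> prime and a perfect algebra over the field with \<open>p\<close> elements, \<open>beta p n\<close>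
  is an isomorphism from \<open>witt_ring p n\<close> onto \<open>ZRing Quot aug_pow n\<close>; \<open>alpha p n\<close>
  is its inverse.
\<close>

definition alpha :: "nat \<Rightarrow> nat \<Rightarrow> 'r::{comm_ring, comm_monoid_mult} ZR set \<Rightarrow> nat \<Rightarrow> 'r" where
  "alpha p n = inv_into (carrier (witt_ring p n)) (beta p n)"

end

theory Submission
  imports Defs
begin

text \<open>
  The map \<open>delta\<close> sends \<open>I^(m+1)\<close> into \<open>I^m\<close>, and it descends to a map
  \<open>ZR/I^(m+1) \<rightarrow> ZR/I^m\<close>, because \<open>delta (x + y) - delta x - delta y\<close> is a multiple of \<open>x y\<close>.
  Moreover \<open>delta (p z) = phi z - p^(p-1) z^p\<close>, which is \<open>phi z\<close> modulo \<open>I^(p-1)\<close>.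
  Hence, if \<open>y\<close> is congruent to the sum of the \<open>p^k [phi^(-k) s_k]\<close>, \<open>k \<le> m\<close>, modulo \<open>I^(m+1)\<close>
  and \<open>m < p\<close>, then \<open>delta (y - [s_0])\<close> is congruent modulo \<open>I^m\<close> to the same kind of sum for
  the shifted sequence \<open>s_1, s_2, \<dots>\<close>; the projection reads off its first entry. That every class
  modulo \<open>I^n\<close> is such a sum follows from \<open>I \<subseteq> I^p + p ZR\<close>: every element of \<open>I\<close> is
  \<open>phi z\<close> for some \<open>z\<close> in \<open>I\<close>, hence is congruent to \<open>z^p\<close> modulo \<open>p\<close>.
\<close>

section \<open>The ring structure of the monoid algebra\<close>

lemma prime_power_add_expansion:
  fixes x y :: "'a::comm_ring_1"
  assumes "prime p"
  shows "\<exists>t. (x + y) ^ p = x ^ p + y ^ p + of_nat p * (x * y * t)"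
proof -
  define t where "t = (\<Sum>k\<in>{1..<p}. of_nat ((p choose k) div p) * x ^ (k - 1) * y ^ (p - k - 1))"
  have p: "p > 1" using assms by (rule prime_gt_1_nat)
  have split: "{..p} = insert 0 (insert p {1..<p})" using p by auto
  have "of_nat (p choose k) * x ^ k * y ^ (p - k)
      = of_nat p * (x * y * (of_nat ((p choose k) div p) * x ^ (k - 1) * y ^ (p - k - 1)))"
    if "k \<in> {1..<p}" for k
  proof -
    have "p dvd p choose k" using that assms by (intro dvd_choose_prime) auto
    then have "of_nat (p choose k) = (of_nat p * of_nat ((p choose k) div p) :: 'a)"
      by (metis dvd_mult_div_cancel of_nat_mult)
    moreover have "x ^ k = x * x ^ (k - 1)"
      using that by (metis atLeastLessThan_iff not_one_le_zero power_eq_if)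
    moreover have "y ^ (p - k) = y * y ^ (p - k - 1)"
      using that by (metis atLeastLessThan_iff power_eq_if zero_less_diff less_numeral_extra(3))
    ultimately show ?thesis by (simp add: mult_ac)
  qed
  then have "(\<Sum>k\<in>{1..<p}. of_nat (p choose k) * x ^ k * y ^ (p - k)) = of_nat p * (x * y * t)"
    unfolding t_def sum_distrib_left by (rule sum.cong[OF refl])
  then have "(x + y) ^ p = x ^ p + y ^ p + of_nat p * (x * y * t)"
    using p unfolding binomial_ring split by simp
  then show ?thesis ..
qed

lemma frag_cmul_eq_mult:
  "frag_cmul k (x :: 'r::comm_monoid_mult ZR) = of_int k * x"
proof -
  have nat: "frag_cmul (int j) x = of_nat j * x" for j
    by (induction j) (simp_all add: frag_cmul_distrib algebra_simps)
  show ?thesis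
  proof (cases k)
    case (nonneg j)
    then show ?thesis by (simp add: nat)
  next
    case (neg j)
    then show ?thesis
      using nat[of "Suc j"] by (simp flip: minus_frag_cmul del: of_nat_Suc)
  qed
qed

lemma of_nat_mult_cancel:
  fixes x y :: "'r::comm_monoid_mult ZR"
  assumes "of_nat p * x = of_nat p * y" "p > 0"
  shows "x = y"
proof -
  have "frag_cmul (int p) (x - y) = 0"
    using assms(1) by (simp add: frag_cmul_eq_mult algebra_simps)
  then show ?thesis using assms(2) by simp
qed

lemma ZR_induct [case_names zero symb diff]:
  fixes x :: "'r ZR"
  assumes "P 0" "\<And>r. P (symb r)" "\<And>a b. P a \<Longrightarrow> P b \<Longrightarrow> P (a - b)"
  shows "P x"
proof (rule frag_induction[of x UNIV])
  fix m :: "'r mulmon"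
  show "P (frag_of m)" using assms(2)[of "unMul m"] by (simp add: symb_def)
qed (use assms in auto)

lemma zmult_0 [simp]: "zmult 0 a = 0"
  by (simp add: zmult_def)

lemma zmult_1 [simp]: "zmult 1 a = a"
  by (simp add: zmult_def)

lemma zmult_int_diff: "zmult (int i - int j) a = zmult (int i) a - zmult (int j) a"
proof (cases "j \<le> i")
  case True
  then obtain d where "i = j + d" using le_Suc_ex by blast
  moreover have "(\<Sum>l<j + d. a) = (\<Sum>l<j. a) + (\<Sum>l<d. a)"
    by (induction d) (simp_all add: algebra_simps)
  ultimately show ?thesis by (simp add: zmult_def nat_int_add)
next
  case False
  then obtain d where "j = i + d" "d > 0" using less_imp_add_positive by (metis not_le)
  moreover have "(\<Sum>l<i + d. a) = (\<Sum>l<i. a) + (\<Sum>l<d. a)"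
    by (induction d) (simp_all add: algebra_simps)
  ultimately show ?thesis by (simp add: zmult_def nat_int_add)
qed

lemma zmult_diff: "zmult (k - l) a = zmult k a - zmult l a"
proof -
  obtain i j where k: "k = int i - int j" by (rule int_diff_cases)
  obtain i' j' where l: "l = int i' - int j'" by (rule int_diff_cases)
  have add: "zmult (int (u + v)) a = zmult (int u) a + zmult (int v) a" for u v
    using zmult_int_diff[of "u + v" v a] by (simp add: algebra_simps)
  have "k - l = int (i + j') - int (j + i')" by (simp add: k l)
  then have "zmult (k - l) a = zmult (int (i + j')) a - zmult (int (j + i')) a"
    by (simp only: zmult_int_diff)
  then show ?thesis by (simp add: add k l zmult_int_diff del: of_nat_add)
qed

lemma proj_superset:
  assumes "finite A" "Poly_Mapping.keys x \<subseteq> A"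
  shows "proj x = (\<Sum>m\<in>A. zmult (Poly_Mapping.lookup x m) (unMul m))"
  unfolding proj_def using assms
  by (intro sum.mono_neutral_left) (auto simp: in_keys_iff)

lemma proj_diff: "proj (x - y) = proj x - proj y"
proof -
  let ?A = "Poly_Mapping.keys x \<union> Poly_Mapping.keys y"
  have "Poly_Mapping.keys (x - y) \<subseteq> ?A" by (rule keys_diff)
  then show ?thesis
    by (simp add: proj_superset[of ?A] lookup_minus zmult_diff sum_subtractf)
qed

lemma proj_0 [simp]: "proj 0 = 0"
  by (simp add: proj_def)

lemma proj_add: "proj (x + y) = proj x + proj y"
  using proj_diff[of "x + y" y] by (simp add: algebra_simps)

lemma proj_symb [simp]: "proj (symb r) = r"
  by (simp add: proj_def symb_def)

lemma proj_1 [simp]: "proj 1 = 1"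
  by (metis proj_symb symb_1)

lemma proj_mult: "proj (x * y) = proj x * proj y"
proof (induction x rule: ZR_induct)
  case (symb r)
  show ?case
    by (induction y rule: ZR_induct) (simp_all add: symb_mult proj_diff right_diff_distrib)
qed (simp_all add: proj_diff left_diff_distrib)

lemma proj_power: "proj (x ^ k) = proj x ^ k"
  by (induction k) (simp_all add: proj_mult)

lemma proj_of_nat: "proj (of_nat k :: 'r::{comm_ring, comm_monoid_mult} ZR) = zmult (int k) 1"
proof (induction k)
  case (Suc k)
  have "zmult (int (Suc k)) (1::'r) = zmult (int k) 1 + 1"
    using zmult_int_diff[of "Suc k" k "1::'r"] by (simp add: algebra_simps)
  then show ?case using Suc by (simp add: proj_add)
qed simp

lemma phi_diff: "phi p (x - y) = phi p x - phi p y"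
  by (simp add: phi_def frag_extend_diff)

lemma phi_add: "phi p (x + y) = phi p x + phi p y"
  by (simp add: phi_def frag_extend_add)

lemma phi_0 [simp]: "phi p 0 = 0"
  by (simp add: phi_def)

lemma phi_symb [simp]: "phi p (symb r) = symb (frob p r)"
  by (simp add: phi_def symb_def)

lemma phi_mult: "phi p (x * y) = phi p x * phi p y"
proof (induction x rule: ZR_induct)
  case (symb r)
  show ?case
    by (induction y rule: ZR_induct)
      (simp_all add: symb_mult phi_diff right_diff_distrib frob_def power_mult_distrib)
qed (simp_all add: phi_diff left_diff_distrib)

lemma phi_1 [simp]: "phi p 1 = 1"
  by (metis phi_symb symb_1 frob_def power_one)

lemma phi_of_nat [simp]: "phi p (of_nat k) = of_nat k"
  by (induction k) (simp_all add: phi_add)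

lemma phi_power: "phi p (x ^ k) = phi p x ^ k"
  by (induction k) (simp_all add: phi_mult)

lemma phi_sum: "phi p (sum f A) = (\<Sum>a\<in>A. phi p (f a))"
  by (induction A rule: infinite_finite_induct) (simp_all add: phi_add)

lemma surj_phi:
  fixes x :: "'r::{comm_ring, comm_monoid_mult} ZR"
  assumes "bij (frob p :: 'r \<Rightarrow> 'r)"
  obtains z where "phi p z = x"
proof -
  have "\<exists>z. phi p z = x"
  proof (induction x rule: ZR_induct)
    case zero
    show ?case using phi_0 by blast
  next
    case (symb r)
    have "frob p (inv_into UNIV (frob p) r) = r" using assms by (simp add: bij_is_surj surj_f_inv_f)
    then show ?case by (metis phi_symb)
  next
    case (diff a b)
    then show ?case by (metis phi_diff)
  qed
  then show ?thesis using that by blast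
qed

section \<open>The arithmetic derivation\<close>

lemma symb_power: "symb r ^ k = symb (r ^ k)"
  by (induction k) (simp_all add: symb_1 symb_mult)

lemma of_nat_dvd_phi_minus_power:
  assumes "prime p"
  shows "of_nat p dvd phi p x - x ^ p"
proof (induction x rule: ZR_induct)
  case zero
  show ?case using prime_gt_0_nat[OF assms] by (simp add: zero_power)
next
  case (symb r)
  show ?case by (simp add: symb_power frob_def)
next
  case (diff a b)
  obtain t where "(a - b + b) ^ p = (a - b) ^ p + b ^ p + of_nat p * ((a - b) * b * t)"
    using prime_power_add_expansion[OF assms] by blast
  then have "phi p (a - b) - (a - b) ^ p
      = (phi p a - a ^ p) - (phi p b - b ^ p) + of_nat p * ((a - b) * b * t)"
    by (simp add: phi_diff)
  then show ?case using diff by (metis dvd_add dvd_diff dvd_triv_left)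
qed

lemma of_nat_mult_delta:
  assumes "prime p"
  shows "of_nat p * delta p x = phi p x - x ^ p"
proof -
  obtain y where y: "phi p x - x ^ p = of_nat p * y"
    using of_nat_dvd_phi_minus_power[OF assms] by blast
  then have "\<exists>!y. of_nat p * y = phi p x - x ^ p"
    using of_nat_mult_cancel[of p] prime_gt_0_nat[OF assms] by metis
  then show ?thesis unfolding delta_def by (rule theI')
qed

lemma delta_eqI:
  assumes "prime p" "of_nat p * y = phi p x - x ^ p"
  shows "delta p x = y"
  using assms of_nat_mult_cancel[of p "delta p x" y] of_nat_mult_delta[OF assms(1), of x]
    prime_gt_0_nat[OF assms(1)] by simp

lemma delta_add:
  assumes "prime p"
  shows "\<exists>t. delta p (x + y) = delta p x + delta p y - x * y * t"
proof -
  obtain t where t: "(x + y) ^ p = x ^ p + y ^ p + of_nat p * (x * y * t)"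
    using prime_power_add_expansion[OF assms] by blast
  have "of_nat p * (delta p x + delta p y - x * y * t)
      = of_nat p * delta p x + of_nat p * delta p y - of_nat p * (x * y * t)"
    by (simp add: algebra_simps)
  also have "\<dots> = phi p (x + y) - (x + y) ^ p"
    by (simp add: t of_nat_mult_delta[OF assms] phi_add)
  finally show ?thesis using delta_eqI[OF assms] by blast
qed

lemma delta_mult:
  assumes "prime p"
  shows "delta p (x * y) = phi p x * delta p y + delta p x * y ^ p"
proof (rule delta_eqI[OF assms])
  have "of_nat p * (phi p x * delta p y + delta p x * y ^ p)
      = phi p x * (of_nat p * delta p y) + (of_nat p * delta p x) * y ^ p"
    by (simp add: algebra_simps)
  also have "\<dots> = phi p (x * y) - (x * y) ^ p"
    by (simp add: of_nat_mult_delta[OF assms] phi_mult algebra_simps power_mult_distrib)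
  finally show "of_nat p * (phi p x * delta p y + delta p x * y ^ p)
      = phi p (x * y) - (x * y) ^ p" .
qed

lemma delta_of_nat_mult:
  assumes "prime p"
  shows "delta p (of_nat p * z) = phi p z - of_nat p ^ (p - 1) * z ^ p"
proof (rule delta_eqI[OF assms])
  have "(of_nat p :: 'a ZR) ^ p = of_nat p * of_nat p ^ (p - 1)"
    using prime_gt_0_nat[OF assms] by (simp add: power_eq_if)
  then show "of_nat p * (phi p z - of_nat p ^ (p - 1) * z ^ p)
      = phi p (of_nat p * z) - (of_nat p * z) ^ p"
    by (simp add: phi_mult algebra_simps power_mult_distrib)
qed

lemma proj_phi:
  fixes x :: "'r::{comm_ring, comm_monoid_mult} ZR"
  assumes "prime p" "zmult (int p) (1 :: 'r) = 0"
  shows "proj (phi p x) = proj x ^ p"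
proof -
  have "phi p x = of_nat p * delta p x + x ^ p"
    by (simp add: of_nat_mult_delta[OF assms(1)])
  then show ?thesis by (simp add: proj_add proj_mult proj_power proj_of_nat assms(2))
qed

section \<open>Powers of the augmentation ideal\<close>

lemma aug_pow_0: "aug_pow 0 = UNIV"
  by (simp add: aug_pow_def nat_pow_def ideals_set_def ring_of_type_algebra_def)

lemma aug_pow_Suc: "aug_pow (Suc n) = ideal_prod ZRing (aug_pow n) aug"
  by (simp add: aug_pow_def nat_pow_def ideals_set_def)

lemma aug_pow_induct [consumes 1, case_names mult add]:
  assumes "x \<in> aug_pow (Suc n)"
    and "\<And>a b. a \<in> aug_pow n \<Longrightarrow> b \<in> aug \<Longrightarrow> P (a * b)"
    and "\<And>a b. a \<in> aug_pow (Suc n) \<Longrightarrow> b \<in> aug_pow (Suc n) \<Longrightarrow> P a \<Longrightarrow> P b \<Longrightarrow> P (a + b)"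
  shows "P x"
  using assms(1) unfolding aug_pow_Suc
proof (induction x rule: ideal_prod.induct)
  case (prod i j)
  then show ?case using assms(2) by (simp add: ring_of_type_algebra_def)
next
  case (sum s1 s2)
  then show ?case using assms(3) by (simp add: aug_pow_Suc ring_of_type_algebra_def)
qed

lemma aug_pow_mult_aug: "a \<in> aug_pow n \<Longrightarrow> b \<in> aug \<Longrightarrow> a * b \<in> aug_pow (Suc n)"
  unfolding aug_pow_Suc using ideal_prod.prod[of a "aug_pow n" b aug ZRing]
  by (simp add: ring_of_type_algebra_def)

lemma aug_pow_add: "a \<in> aug_pow n \<Longrightarrow> b \<in> aug_pow n \<Longrightarrow> a + b \<in> aug_pow n"
proof (cases n)
  case (Suc m)
  assume "a \<in> aug_pow n" "b \<in> aug_pow n"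
  then show ?thesis
    unfolding Suc aug_pow_Suc using ideal_prod.sum[of a ZRing "aug_pow m" aug b]
    by (simp add: ring_of_type_algebra_def)
qed (simp add: aug_pow_0)

lemma aug_pow_mult: "a \<in> aug_pow n \<Longrightarrow> a * b \<in> aug_pow n"
proof (cases n)
  case (Suc m)
  assume "a \<in> aug_pow n"
  then show ?thesis
    unfolding Suc
  proof (induction a rule: aug_pow_induct)
    case (mult u v)
    then have "v * b \<in> aug" by (simp add: aug_def proj_mult)
    then show ?case using mult aug_pow_mult_aug by (metis mult.assoc)
  next
    case (add u v)
    then show ?case by (simp add: distrib_right aug_pow_add)
  qed
qed (simp add: aug_pow_0)

lemma aug_pow_diff:
  assumes "a \<in> aug_pow n" "b \<in> aug_pow n"
  shows "a - b \<in> aug_pow n"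
  using aug_pow_add[OF assms(1) aug_pow_mult[OF assms(2), of "- 1"]] by simp

lemma zero_in_aug_pow [simp]: "0 \<in> aug_pow n"
proof (induction n)
  case (Suc n)
  then show ?case using aug_pow_mult_aug[of 0 n 0] by (simp add: aug_def)
qed (simp add: aug_pow_0)

lemma aug_pow_Suc_subset: "aug_pow (Suc n) \<subseteq> aug_pow n"
proof
  fix x :: "'a ZR"
  assume "x \<in> aug_pow (Suc n)"
  then show "x \<in> aug_pow n"
    by (induction x rule: aug_pow_induct) (simp_all add: aug_pow_mult aug_pow_add)
qed

lemma aug_pow_antimono: "m \<le> n \<Longrightarrow> aug_pow n \<subseteq> aug_pow m"
  by (rule lift_Suc_antimono_le[of aug_pow]) (rule aug_pow_Suc_subset)

lemma power_in_aug_pow: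
  assumes "a \<in> aug" "n \<le> k"
  shows "a ^ k \<in> aug_pow n"
proof -
  have "a ^ k \<in> aug_pow k"
  proof (induction k)
    case (Suc k)
    then show ?case using aug_pow_mult_aug[OF _ assms(1), of "a ^ k" k] by (simp add: mult.commute)
  qed (simp add: aug_pow_0)
  then show ?thesis using aug_pow_antimono[OF assms(2)] by blast
qed

lemma aug_pow_Suc_subset_aug: "aug_pow (Suc n) \<subseteq> aug"
proof
  fix x :: "'a ZR"
  assume "x \<in> aug_pow (Suc n)"
  then show "x \<in> aug"
    by (induction x rule: aug_pow_induct) (simp_all add: aug_def proj_mult proj_add)
qed

lemma delta_aug_pow:
  fixes x :: "'r::{comm_ring, comm_monoid_mult} ZR"
  assumes "prime p" "zmult (int p) (1 :: 'r) = 0" "x \<in> aug_pow (Suc n)"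
  shows "delta p x \<in> aug_pow n"
  using assms(3)
proof (induction n arbitrary: x)
  case 0
  show ?case by (simp add: aug_pow_0)
next
  case (Suc n)
  have p: "p > 0" using assms(1) by (rule prime_gt_0_nat)
  from Suc.prems show ?case
  proof (induction x rule: aug_pow_induct)
    case (mult a b)
    have "phi p b \<in> aug" using mult p by (simp add: aug_def proj_phi[OF assms(1,2)] power_eq_if)
    then have "phi p b * delta p a \<in> aug_pow (Suc n)"
      using aug_pow_mult_aug[OF Suc.IH[OF mult(1)]] by (subst mult.commute)
    moreover have "a ^ p \<in> aug_pow (Suc n)"
      using aug_pow_mult[OF mult(1), of "a ^ (p - 1)"] p by (simp add: power_eq_if)
    then have "delta p b * a ^ p \<in> aug_pow (Suc n)"
      using aug_pow_mult by (metis mult.commute)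
    ultimately show ?case
      using delta_mult[OF assms(1), of b a] by (simp add: aug_pow_add mult.commute)
  next
    case (add a b)
    obtain t where "delta p (a + b) = delta p a + delta p b - a * b * t"
      using delta_add[OF assms(1)] by blast
    moreover have "a * b * t \<in> aug_pow (Suc n)"
      using add(1) aug_pow_mult aug_pow_Suc_subset by blast
    ultimately show ?case using add by (simp add: aug_pow_add aug_pow_diff)
  qed
qed

lemma delta_cong:
  fixes x y :: "'r::{comm_ring, comm_monoid_mult} ZR"
  assumes "prime p" "zmult (int p) (1 :: 'r) = 0" "y - x \<in> aug_pow (Suc n)"
  shows "delta p y - delta p x \<in> aug_pow n"
proof -
  obtain t where "delta p (y - x + x) = delta p (y - x) + delta p x - (y - x) * x * t"
    using delta_add[OF assms(1)] by blast
  then have "delta p y - delta p x = delta p (y - x) - (y - x) * x * t" by simp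
  moreover have "(y - x) * x * t \<in> aug_pow n"
    using assms(3) aug_pow_mult aug_pow_Suc_subset by blast
  ultimately show ?thesis using delta_aug_pow[OF assms] by (simp add: aug_pow_diff)
qed

section \<open>Digit expansions\<close>

definition digit_sum ::
  "nat \<Rightarrow> nat \<Rightarrow> (nat \<Rightarrow> 'r::{comm_ring, comm_monoid_mult}) \<Rightarrow> 'r ZR" where
  "digit_sum p n s = (\<Sum>k<n. of_nat p ^ k * symb ((inv_into UNIV (frob p) ^^ k) (s k)))"

lemma beta_eq: "beta p n s = {h + digit_sum p n s | h. h \<in> aug_pow n}"
  by (auto simp: beta_def digit_sum_def a_r_coset_def r_coset_def ring_of_type_algebra_def)

lemma digit_sum_Suc:
  "digit_sum p (Suc m) s = symb (s 0)
    + of_nat p * (\<Sum>k<m. of_nat p ^ k * symb ((inv_into UNIV (frob p) ^^ Suc k) (s (Suc k))))"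
  unfolding digit_sum_def
  by (subst sum.lessThan_Suc_shift) (simp add: sum_distrib_left mult.assoc)

lemma delta_digit_sum:
  fixes s :: "nat \<Rightarrow> 'r::{comm_ring, comm_monoid_mult}"
  assumes "prime p" "zmult (int p) (1 :: 'r) = 0" "bij (frob p :: 'r \<Rightarrow> 'r)"
    and "m < p" "y - digit_sum p (Suc m) s \<in> aug_pow (Suc m)"
  shows "delta p (y - symb (s 0)) - digit_sum p m (\<lambda>k. s (Suc k)) \<in> aug_pow m"
proof -
  define z where
    "z = (\<Sum>k<m. of_nat p ^ k * symb ((inv_into UNIV (frob p) ^^ Suc k) (s (Suc k))))"
  have "frob p (inv_into UNIV (frob p) r) = r" for r :: 'r
    using assms(3) by (simp add: bij_is_surj surj_f_inv_f)
  then have phi_z: "phi p z = digit_sum p m (\<lambda>k. s (Suc k))"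
    by (simp add: z_def digit_sum_def phi_sum phi_mult phi_power)
  have "(y - symb (s 0)) - of_nat p * z \<in> aug_pow (Suc m)"
    using assms(5) unfolding digit_sum_Suc z_def by (simp add: diff_diff_eq)
  then have "delta p (y - symb (s 0)) - delta p (of_nat p * z) \<in> aug_pow m"
    by (rule delta_cong[OF assms(1,2)])
  then have "delta p (y - symb (s 0)) - phi p z + of_nat p ^ (p - 1) * z ^ p \<in> aug_pow m"
    unfolding delta_of_nat_mult[OF assms(1)] by (simp add: algebra_simps)
  moreover have "of_nat p ^ (p - 1) * z ^ p \<in> aug_pow m"
    using assms(2,4) by (intro aug_pow_mult power_in_aug_pow) (simp_all add: aug_def proj_of_nat)
  ultimately show ?thesis
    unfolding phi_z using aug_pow_diff by fastforce
qed

lemma proj_eq_first_digit: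
  fixes s :: "nat \<Rightarrow> 'r::{comm_ring, comm_monoid_mult}"
  assumes "zmult (int p) (1 :: 'r) = 0" "y - digit_sum p (Suc m) s \<in> aug_pow (Suc m)"
  shows "proj y = s 0"
proof -
  have "proj (y - digit_sum p (Suc m) s) = 0"
    using assms(2) aug_pow_Suc_subset_aug by (auto simp: aug_def)
  then show ?thesis
    by (simp add: digit_sum_Suc proj_diff proj_add proj_mult proj_of_nat assms(1))
qed

lemma aug_decomposition:
  fixes x :: "'r::{comm_ring, comm_monoid_mult} ZR"
  assumes "prime p" "zmult (int p) (1 :: 'r) = 0" "bij (frob p :: 'r \<Rightarrow> 'r)"
    and "n \<le> p" "x \<in> aug"
  shows "\<exists>w. x - of_nat p * w \<in> aug_pow n"
proof -
  have p: "p > 0" using assms(1) by (rule prime_gt_0_nat)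
  obtain z where z: "phi p z = x" using surj_phi[OF assms(3)] by blast
  have "frob p (proj z) = frob p 0"
    using assms(5) p z[symmetric] by (simp add: aug_def proj_phi[OF assms(1,2)] frob_def power_eq_if)
  then have "z \<in> aug" using assms(3) by (auto simp: aug_def bij_def dest: injD)
  then have "z ^ p \<in> aug_pow n" using assms(4) by (rule power_in_aug_pow)
  moreover have "x - of_nat p * delta p z = z ^ p" by (simp add: of_nat_mult_delta[OF assms(1)] z)
  ultimately show ?thesis by metis
qed

lemma digit_sum_exists:
  fixes a :: "'r::{comm_ring, comm_monoid_mult} ZR"
  assumes "prime p" "zmult (int p) (1 :: 'r) = 0" "bij (frob p :: 'r \<Rightarrow> 'r)" "n \<le> p"
  shows "\<exists>s\<in>{..<n} \<rightarrow>\<^sub>E UNIV. a - digit_sum p n s \<in> aug_pow n"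
proof -
  have "\<exists>s w. a - (\<Sum>k<m. of_nat p ^ k * symb (s k)) - of_nat p ^ m * w \<in> aug_pow n" for m
  proof (induction m)
    case 0
    have "a - (\<Sum>k<0. of_nat p ^ k * symb (undefined k)) - of_nat p ^ 0 * a \<in> aug_pow n" by simp
    then show ?case by blast
  next
    case (Suc m)
    then obtain s w where
      sw: "a - (\<Sum>k<m. of_nat p ^ k * symb (s k)) - of_nat p ^ m * w \<in> aug_pow n" by blast
    have "w - symb (proj w) \<in> aug" by (simp add: aug_def proj_diff)
    then obtain v where v: "w - symb (proj w) - of_nat p * v \<in> aug_pow n"
      using aug_decomposition[OF assms] by blast
    let ?s = "s(m := proj w)"
    have "a - (\<Sum>k<Suc m. of_nat p ^ k * symb (?s k)) - of_nat p ^ Suc m * v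
        = (a - (\<Sum>k<m. of_nat p ^ k * symb (s k)) - of_nat p ^ m * w)
          + (w - symb (proj w) - of_nat p * v) * of_nat p ^ m"
      by (simp add: algebra_simps)
    then have "a - (\<Sum>k<Suc m. of_nat p ^ k * symb (?s k)) - of_nat p ^ Suc m * v \<in> aug_pow n"
      using aug_pow_add[OF sw aug_pow_mult[OF v]] by (simp only:)
    then show ?case by blast
  qed
  then obtain s w where
    sw: "a - (\<Sum>k<n. of_nat p ^ k * symb (s k)) - of_nat p ^ n * w \<in> aug_pow n" by blast
  have "of_nat p ^ n * w \<in> aug_pow n"
    using assms(2) by (intro aug_pow_mult power_in_aug_pow) (simp_all add: aug_def proj_of_nat)
  then have "a - (\<Sum>k<n. of_nat p ^ k * symb (s k)) \<in> aug_pow n"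
    using aug_pow_add[OF sw, of "of_nat p ^ n * w"] by simp
  moreover have "(inv_into UNIV (frob p) ^^ k) ((frob p ^^ k) r) = r" for k and r :: 'r
    using assms(3) by (simp add: bij_is_inj inj_fn inv_fn[symmetric])
  then have "digit_sum p n (\<lambda>k\<in>{..<n}. (frob p ^^ k) (s k)) = (\<Sum>k<n. of_nat p ^ k * symb (s k))"
    by (simp add: digit_sum_def)
  ultimately show ?thesis
    by (intro bexI[of _ "\<lambda>k\<in>{..<n}. (frob p ^^ k) (s k)"]) auto
qed

lemma alpha_digit_sum:
  fixes x :: "'r::{comm_ring, comm_monoid_mult} ZR"
  assumes "prime p" "zmult (int p) (1 :: 'r) = 0" "bij (frob p :: 'r \<Rightarrow> 'r)" "n \<le> p"
    and "c \<in> carrier (ZRing Quot aug_pow n)" "x \<in> c"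
  shows "x - digit_sum p n (alpha p n c) \<in> aug_pow n"
proof -
  obtain a where c: "c = {h + a | h. h \<in> aug_pow n}"
    using assms(5)
    by (auto simp: FactRing_def A_RCOSETS_def' a_r_coset_def r_coset_def ring_of_type_algebra_def)
  obtain s where s: "s \<in> {..<n} \<rightarrow>\<^sub>E UNIV" "a - digit_sum p n s \<in> aug_pow n"
    using digit_sum_exists[OF assms(1-4)] by blast
  have "c = beta p n s"
  proof (intro equalityI subsetI)
    fix u
    assume "u \<in> c"
    then have "u - a \<in> aug_pow n" by (auto simp: c)
    then have "u - a + (a - digit_sum p n s) \<in> aug_pow n" using s(2) by (rule aug_pow_add)
    then show "u \<in> beta p n s"
      unfolding beta_eq by (intro CollectI exI[of _ "u - digit_sum p n s"]) simp
  next
    fix u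
    assume "u \<in> beta p n s"
    then have "u - digit_sum p n s \<in> aug_pow n" by (auto simp: beta_eq)
    then have "u - digit_sum p n s - (a - digit_sum p n s) \<in> aug_pow n"
      using s(2) by (rule aug_pow_diff)
    then show "u \<in> c"
      unfolding c by (intro CollectI exI[of _ "u - a"]) simp
  qed
  then have "c \<in> beta p n ` carrier (witt_ring p n)"
    using s(1) by (simp add: witt_ring_def)
  then have "beta p n (alpha p n c) = c" unfolding alpha_def by (rule f_inv_into_f)
  then have "x \<in> beta p n (alpha p n c)" using assms(6) by simp
  then show ?thesis by (auto simp: beta_eq)
qed

theorem theorem3:
  fixes p n :: nat
    and c :: "'r::{comm_ring, comm_monoid_mult} ZR set"
    and x :: "'r ZR"
    and r :: "nat \<Rightarrow> 'r"
    and y :: "nat \<Rightarrow> 'r ZR"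
  assumes "prime p"
    and "zmult (int p) (1 :: 'r) = 0"
    and "bij (frob p :: 'r \<Rightarrow> 'r)"
    and "n \<ge> 2" and "p \<ge> n"
    and "c \<in> carrier (ZRing Quot aug_pow n)"
    and "r = alpha p n c"
    and "x \<in> c"
    and "y 0 = x"
    and "\<And>\<nu>. 1 \<le> \<nu> \<Longrightarrow> \<nu> \<le> n - 1 \<Longrightarrow> y \<nu> = delta p (y (\<nu> - 1) - symb (r (\<nu> - 1)))"
  shows "\<forall>\<nu>\<le>n - 1. r \<nu> = proj (y \<nu>)"
proof -
  have step: "y \<nu> - digit_sum p (n - \<nu>) (\<lambda>k. r (k + \<nu>)) \<in> aug_pow (n - \<nu>)" if "\<nu> \<le> n - 1" for \<nu>
    using that
  proof (induction \<nu>)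
    case 0
    show ?case using alpha_digit_sum[OF assms(1-3,5,6,8)] assms(7,9) by simp
  next
    case (Suc \<nu>)
    define m where "m = n - Suc \<nu>"
    have m: "n - \<nu> = Suc m" "m < p" using Suc.prems assms(4,5) by (auto simp: m_def)
    have "delta p (y \<nu> - symb (r (0 + \<nu>))) - digit_sum p m (\<lambda>k. r (Suc k + \<nu>)) \<in> aug_pow m"
      using Suc m by (intro delta_digit_sum[OF assms(1-3)]) simp_all
    then show ?case using assms(10)[of "Suc \<nu>"] Suc.prems by (simp add: m_def)
  qed
  show ?thesis
  proof (intro allI impI)
    fix \<nu>
    assume "\<nu> \<le> n - 1"
    moreover from this obtain m where "n - \<nu> = Suc m"
      using assms(4) by (metis Suc_diff_le Suc_diff_1 less_le_trans pos2)
    ultimately have "y \<nu> - digit_sum p (Suc m) (\<lambda>k. r (k + \<nu>)) \<in> aug_pow (Suc m)"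
      using step by metis
    then show "r \<nu> = proj (y \<nu>)" using proj_eq_first_digit[OF assms(2)] by fastforce
  qed
qed

end
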